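(* For every fixed-antenna position $q_{\mathrm f}\in[q_0,q_{\max}]$, the uplink capacity region of the conventional fixed-antenna system is contained in the uplink capacity region of the pinching-antenna system with one pinching antenna: $\mathcal C_{\mathrm f}^{\mathrm U}\subseteq\mathcal C^{\mathrm U}$.
   Context: Let $\eta,\sigma^2,d_1,d_2,P_1,P_2>0$, and let $x_1\le x_2$, $q_0\le q_{\max}$ be reals with $[x_1,x_2]\subseteq[q_0,q_{\max}]$. For $q\in\mathbb R$ put $|h_k(q)|^2=\frac{\eta}{d_k^2+(x_k-q)^2}$ for $k\in\{1,2\}$, and let $\mathcal C^{\mathrm U}(q)$ be the set of pairs $(R_1,R_2)$ with $R_1,R_2\ge0$, $$R_k\le\log_2\big(1+P_k|h_k(q)|^2/\sigma^2\big)\ (k=1,2),\qquad R_1+R_2\le\log_2\big(1+(P_1|h_1(q)|^2+P_2|h_2(q)|^2)/\sigma^2\big).$$ The fixed-antenna capacity region (antenna at coordinate $q_{\mathrm f}$) is $\mathcal C_{\mathrm f}^{\mathrm U}=\mathcal C^{\mathrm U}(q_{\mathrm f})$. The capacity region of the single-pinch system is $\mathcal C^{\mathrm U}=\mathrm{Conv}\big(\bigcup_{q\in[x_1,x_2]}\mathcal C^{\mathrm U}(q)\big)$, where $\mathrm{Conv}$ denotes the convex hull (this equals the convex hull of the union over $q\in[q_0,q_{\max}]$). *)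

theory Defs
  imports "HOL-Analysis.Analysis"
begin

text \<open>
  The squared channel magnitude \<open>\<bar>h\<^sub>k(q)\<bar>\<^sup>2\<close> of a user with coordinate \<open>x\<close> and distance \<open>d\<close> to
  the waveguide, for an antenna at coordinate \<open>q\<close>. Below, the parameter \<open>\<sigma>2\<close> stands for the
  noise power \<open>\<sigma>\<^sup>2\<close> itself.
\<close>

definition channel_gain :: "real \<Rightarrow> real \<Rightarrow> real \<Rightarrow> real \<Rightarrow> real" where
  "channel_gain \<eta> d x q = \<eta> / (d\<^sup>2 + (x - q)\<^sup>2)"

definition uplink_region ::
  "real \<Rightarrow> real \<Rightarrow> real \<Rightarrow> real \<Rightarrow> real \<Rightarrow> real \<Rightarrow> real \<Rightarrow> real \<Rightarrow> real \<Rightarrow> (real \<times> real) set" where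
  "uplink_region \<eta> \<sigma>2 d1 d2 P1 P2 x1 x2 q =
    {(R1, R2). 0 \<le> R1 \<and> 0 \<le> R2 \<and>
      R1 \<le> log 2 (1 + P1 * channel_gain \<eta> d1 x1 q / \<sigma>2) \<and>
      R2 \<le> log 2 (1 + P2 * channel_gain \<eta> d2 x2 q / \<sigma>2) \<and>
      R1 + R2 \<le> log 2 (1 + (P1 * channel_gain \<eta> d1 x1 q + P2 * channel_gain \<eta> d2 x2 q) / \<sigma>2)}"

definition fixed_antenna_capacity_region ::
  "real \<Rightarrow> real \<Rightarrow> real \<Rightarrow> real \<Rightarrow> real \<Rightarrow> real \<Rightarrow> real \<Rightarrow> real \<Rightarrow> real \<Rightarrow> (real \<times> real) set" where
  "fixed_antenna_capacity_region \<eta> \<sigma>2 d1 d2 P1 P2 x1 x2 qf =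
    uplink_region \<eta> \<sigma>2 d1 d2 P1 P2 x1 x2 qf"

definition pinching_capacity_region ::
  "real \<Rightarrow> real \<Rightarrow> real \<Rightarrow> real \<Rightarrow> real \<Rightarrow> real \<Rightarrow> real \<Rightarrow> real \<Rightarrow> (real \<times> real) set" where
  "pinching_capacity_region \<eta> \<sigma>2 d1 d2 P1 P2 x1 x2 =
    convex hull (\<Union>q\<in>{x1..x2}. uplink_region \<eta> \<sigma>2 d1 d2 P1 P2 x1 x2 q)"

end

theory Submission
  imports Defs
begin

text \<open>
  Moving the antenna from \<open>qf\<close> to the nearest point of the interval spanned by the users does not
  increase its distance to either user, so it enlarges all three rate bounds.
\<close>

lemma channel_gain_nonneg:
  "\<eta> \<ge> 0 \<Longrightarrow> channel_gain \<eta> d x q \<ge> 0"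
  by (simp add: channel_gain_def)

text \<open>The gain decreases in the squared distance. Since \<open>d\<close> is nonzero, the
  denominator stays positive even when the antenna at \<open>p\<close> is level with the user, so
  the reciprocals can be compared.\<close>

lemma channel_gain_mono:
  assumes "\<eta> \<ge> 0" and "d \<noteq> 0" and "\<bar>x - p\<bar> \<le> \<bar>x - q\<bar>"
  shows "channel_gain \<eta> d x q \<le> channel_gain \<eta> d x p"
proof -
  have "(x - p)\<^sup>2 \<le> (x - q)\<^sup>2"
    using assms(3) by (simp add: abs_le_square_iff)
  moreover have "0 < d\<^sup>2 + (x - p)\<^sup>2"
    using assms(2) by (simp add: add_pos_nonneg)
  ultimately show ?thesis
    unfolding channel_gain_def using assms(1) by (intro divide_left_mono mult_pos_pos) auto
qed

text \<open>All three rate bounds are logarithms that increase in both gains, so raising the two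
  gains together only relaxes the constraints.\<close>

lemma uplink_region_mono:
  assumes "\<eta> \<ge> 0" "\<sigma>2 \<ge> 0" "P1 \<ge> 0" "P2 \<ge> 0"
    and "channel_gain \<eta> d1 x1 q \<le> channel_gain \<eta> d1 x1 p"
    and "channel_gain \<eta> d2 x2 q \<le> channel_gain \<eta> d2 x2 p"
  shows "uplink_region \<eta> \<sigma>2 d1 d2 P1 P2 x1 x2 q \<subseteq> uplink_region \<eta> \<sigma>2 d1 d2 P1 P2 x1 x2 p"
proof -
  \<comment> \<open>The condition \<open>0 \<le> s\<close> keeps the argument of the smaller
    logarithm at least 1, hence positive. Inside this proof \<open>log_mono\<close> still means the
    library fact.\<close>
  have log_mono: "log 2 (1 + s / \<sigma>2) \<le> log 2 (1 + t / \<sigma>2)" if "0 \<le> s" "s \<le> t" for s t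
    using that assms(2) by (intro log_mono add_left_mono divide_right_mono) (auto intro: add_pos_nonneg)
  have le: "P1 * channel_gain \<eta> d1 x1 q \<le> P1 * channel_gain \<eta> d1 x1 p"
    "P2 * channel_gain \<eta> d2 x2 q \<le> P2 * channel_gain \<eta> d2 x2 p"
    using assms by (auto intro: mult_left_mono)
  have nonneg: "0 \<le> P1 * channel_gain \<eta> d1 x1 q" "0 \<le> P2 * channel_gain \<eta> d2 x2 q"
    using assms by (auto intro: mult_nonneg_nonneg channel_gain_nonneg)
  note log_mono[OF nonneg(1) le(1)] log_mono[OF nonneg(2) le(2)]
    log_mono[OF add_nonneg_nonneg[OF nonneg] add_mono[OF le]]
  then show ?thesis
    unfolding uplink_region_def by auto
qed

theorem mainTheorem4:
  fixes \<eta> \<sigma>2 d1 d2 P1 P2 x1 x2 q0 qmax :: real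
  assumes "\<eta> > 0" and "\<sigma>2 > 0" and "d1 > 0" and "d2 > 0" and "P1 > 0" and "P2 > 0"
    and "x1 \<le> x2" and "q0 \<le> qmax" and "{x1..x2} \<subseteq> {q0..qmax}"
  shows "\<forall>qf\<in>{q0..qmax}.
    fixed_antenna_capacity_region \<eta> \<sigma>2 d1 d2 P1 P2 x1 x2 qf
      \<subseteq> pinching_capacity_region \<eta> \<sigma>2 d1 d2 P1 P2 x1 x2"
proof
  fix qf
  \<comment> \<open>\<open>p\<close> is \<open>qf\<close> clamped to the interval: \<open>x1\<close>
    if \<open>qf\<close> lies to its left, \<open>x2\<close> if to its right, \<open>qf\<close>
    itself otherwise. If clamping moves the antenna, it lands on the nearer user and approaches the
    other.\<close>
  define p where "p = max x1 (min x2 qf)"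
  have p: "p \<in> {x1..x2}" "\<bar>x1 - p\<bar> \<le> \<bar>x1 - qf\<bar>" "\<bar>x2 - p\<bar> \<le> \<bar>x2 - qf\<bar>"
    using \<open>x1 \<le> x2\<close> by (auto simp: p_def max_def min_def)
  have "uplink_region \<eta> \<sigma>2 d1 d2 P1 P2 x1 x2 qf \<subseteq> uplink_region \<eta> \<sigma>2 d1 d2 P1 P2 x1 x2 p"
    using assms p by (intro uplink_region_mono channel_gain_mono) auto
  also have "\<dots> \<subseteq> (\<Union>q\<in>{x1..x2}. uplink_region \<eta> \<sigma>2 d1 d2 P1 P2 x1 x2 q)"
    using p(1) by blast
  also have "\<dots> \<subseteq> pinching_capacity_region \<eta> \<sigma>2 d1 d2 P1 P2 x1 x2"
    unfolding pinching_capacity_region_def by (rule hull_subset)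
  finally show "fixed_antenna_capacity_region \<eta> \<sigma>2 d1 d2 P1 P2 x1 x2 qf
      \<subseteq> pinching_capacity_region \<eta> \<sigma>2 d1 d2 P1 P2 x1 x2"
    unfolding fixed_antenna_capacity_region_def .
qed

end
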